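(* Let $K$ be a field and let $I\subset K[x,y]$ be a nonzero lexsegment ideal. Then $\mu(I^2)=2\mu(I)-1$.
   Context: $\mu(L)$ denotes the minimal number of generators of a monomial ideal $L$. A monomial ideal $I\subset K[x,y]$ is called a lexsegment ideal if for all monomials $u\in I$ and all monomials $v$ with $\deg v=\deg u$ and $v>u$ in the lexicographical order (with $x>y$), it follows that $v\in I$. *)

theory Defs
  imports Complex_Main "HOL-Library.Poly_Mapping" "HOL-Library.Product_Plus"
begin

text \<open>
  Finitely supported functions on pairs of exponents, with the convolution product of
  theory \<open>Poly_Mapping\<close>, form the polynomial ring in two variables: the pair \<open>(a, b)\<close>
  stands for the exponent of the monomial \<open>x^a y^b\<close>.
\<close>

type_synonym 'k poly_xy = "(nat \<times> nat) \<Rightarrow>\<^sub>0 'k"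

definition monom_xy :: "nat \<times> nat \<Rightarrow> 'k::field poly_xy" where
  "monom_xy u = Poly_Mapping.single u 1"

definition deg_xy :: "nat \<times> nat \<Rightarrow> nat" where
  "deg_xy u = fst u + snd u"

text \<open>\<open>lex_greater v u\<close> means that the monomial \<open>v\<close> is lexicographically greater than \<open>u\<close>,
  where \<open>x > y\<close>: the exponents of \<open>x\<close> are compared first.\<close>

definition lex_greater :: "nat \<times> nat \<Rightarrow> nat \<times> nat \<Rightarrow> bool" where
  "lex_greater v u \<longleftrightarrow> (u, v) \<in> less_than <*lex*> less_than"

text \<open>Ideals of a commutative ring are its submodules, the ring acting on itself by
  multiplication.\<close>

lemma module_mult: "module ((*) :: 'a::comm_ring_1 \<Rightarrow> 'a \<Rightarrow> 'a)"
  by unfold_locales (simp_all add: algebra_simps)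

definition is_ideal :: "'a::comm_ring_1 set \<Rightarrow> bool" where
  "is_ideal I \<longleftrightarrow> module.subspace (*) I"

definition ideal_gen :: "'a::comm_ring_1 set \<Rightarrow> 'a set" where
  "ideal_gen G = module.span (*) G"

lemma is_ideal_iff:
  "is_ideal I \<longleftrightarrow> 0 \<in> I \<and> (\<forall>f\<in>I. \<forall>g\<in>I. f + g \<in> I) \<and> (\<forall>r. \<forall>f\<in>I. r * f \<in> I)"
  unfolding is_ideal_def module.subspace_def[OF module_mult] ..

lemma is_ideal_ideal_gen: "is_ideal (ideal_gen G)"
  unfolding is_ideal_def ideal_gen_def by (rule module.subspace_span[OF module_mult])

definition ideal_times :: "'a::comm_ring_1 set \<Rightarrow> 'a set \<Rightarrow> 'a set" where
  "ideal_times I J = ideal_gen {f * g | f g. f \<in> I \<and> g \<in> J}"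

primrec ideal_power :: "'a::comm_ring_1 set \<Rightarrow> nat \<Rightarrow> 'a set" where
  "ideal_power I 0 = UNIV"
| "ideal_power I (Suc n) = ideal_times I (ideal_power I n)"

text \<open>The generators counted by \<open>mu\<close> are arbitrary ring elements, not only monomials.  The set
  of cardinalities is nonempty for every ideal of a Noetherian ring.\<close>

definition mu :: "'a::comm_ring_1 set \<Rightarrow> nat" where
  "mu I = (LEAST n. \<exists>G. finite G \<and> card G = n \<and> ideal_gen G = I)"

definition monomial_ideal :: "'k::field poly_xy set \<Rightarrow> bool" where
  "monomial_ideal I \<longleftrightarrow> (\<exists>S. I = ideal_gen (monom_xy ` S))"

definition lexsegment_ideal :: "'k::field poly_xy set \<Rightarrow> bool" where
  "lexsegment_ideal I \<longleftrightarrow> monomial_ideal I \<and>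
    (\<forall>u v. monom_xy u \<in> I \<and> deg_xy v = deg_xy u \<and> lex_greater v u \<longrightarrow> monom_xy v \<in> I)"

end

theory Submission
  imports Defs "HOL-Library.Function_Algebras" "HOL-Library.Set_Algebras"
begin

text \<open>
  A monomial ideal is determined by the upward closed set \<open>E\<close> of exponents of its monomials, and
  products of ideals correspond to sums of exponent sets (\<open>ideal_times_exponent_ideal\<close>).  Its
  minimal number of generators is the number of minimal elements of \<open>E\<close>
  (\<open>mu_exponent_ideal\<close>).  Generators that are not monomials cannot do better: the coefficients
  at the minimal exponents are independent linear forms on the ideal that vanish on its product
  with \<open>(x, y)\<close>, so their values on any generators must span all coefficient vectors over \<open>K\<close>.

  For a lexsegment ideal of \<open>K[x, y]\<close>, the condition says that a factor \<open>y\<close> of a monomial may be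
  exchanged for a factor \<open>x\<close>.  The boundary staircase of \<open>E\<close> then has only steps of width one,
  so there is exactly one minimal exponent in each column from the least \<open>x\<close>-exponent \<open>m\<close>
  occurring in \<open>E\<close> up to the exponent \<open>n\<close> of the least power of \<open>x\<close> in the ideal
  (\<open>bij_betw_minimal_exponents\<close>), and the minimal number of generators is \<open>n - m + 1\<close>.

  The exchange property passes to products, and both \<open>n\<close> and \<open>m\<close> are additive.  Hence
  \<open>mu (I J) = mu I + mu J - 1\<close> for nonzero lexsegment ideals (\<open>mu_ideal_times_lexsegment\<close>);
  the square is the case \<open>I = J\<close>.
\<close>

section \<open>Monomial ideals and their exponent sets\<close>

definition exponent_ideal :: "(nat \<times> nat) set \<Rightarrow> 'k::field poly_xy set" where
  "exponent_ideal E = {p. Poly_Mapping.keys p \<subseteq> E}"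

definition upward_closed :: "(nat \<times> nat) set \<Rightarrow> bool" where
  "upward_closed E \<longleftrightarrow> (\<forall>u\<in>E. \<forall>t. t + u \<in> E)"

lemma upward_closedD: "upward_closed E \<Longrightarrow> u \<in> E \<Longrightarrow> t + u \<in> E"
  unfolding upward_closed_def by blast

lemma upward_closed_UNIV_plus: "upward_closed (UNIV + S)"
  unfolding upward_closed_def
proof (intro ballI allI)
  fix u t assume "u \<in> UNIV + S"
  then obtain v s where "u = v + s" and "s \<in> S" by (rule set_plus_elim)
  then show "t + u \<in> UNIV + S"
    using set_plus_intro[of "t + v" UNIV s S] by (simp add: add.assoc)
qed

lemma upward_closed_set_plus: "upward_closed E \<Longrightarrow> upward_closed (E + F)"
  unfolding upward_closed_def
proof (intro ballI allI)
  fix u t assume "\<forall>u\<in>E. \<forall>t. t + u \<in> E" and "u \<in> E + F"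
  then obtain v w where "u = v + w" and "t + v \<in> E" and "w \<in> F" by (blast elim: set_plus_elim)
  then show "t + u \<in> E + F"
    using set_plus_intro[of "t + v" E w F] by (simp add: add.assoc)
qed

lemma ideal_gen_superset: "g \<in> G \<Longrightarrow> g \<in> ideal_gen G"
  unfolding ideal_gen_def by (rule module.span_base[OF module_mult])

lemma ideal_gen_least: "G \<subseteq> J \<Longrightarrow> is_ideal J \<Longrightarrow> ideal_gen G \<subseteq> J"
  unfolding ideal_gen_def is_ideal_def by (rule module.span_minimal[OF module_mult])

lemma is_ideal_sum:
  assumes "is_ideal J" and "\<And>a. a \<in> A \<Longrightarrow> f a \<in> J"
  shows "sum f A \<in> J"
  using assms unfolding is_ideal_def
  by (intro module.subspace_sum[OF module_mult])

lemma keys_mult_subset: "Poly_Mapping.keys (r * p) \<subseteq> Poly_Mapping.keys r + Poly_Mapping.keys p"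
  for r p :: "'k::field poly_xy"
  using keys_mult[of r p] unfolding set_plus_def by blast

lemma is_ideal_exponent_ideal:
  assumes "upward_closed E"
  shows "is_ideal (exponent_ideal E :: 'k::field poly_xy set)"
  unfolding is_ideal_iff exponent_ideal_def mem_Collect_eq Ball_def
proof (intro conjI allI impI)
  show "Poly_Mapping.keys (0 :: 'k poly_xy) \<subseteq> E" by simp
next
  fix f g :: "'k poly_xy"
  assume "Poly_Mapping.keys f \<subseteq> E" and "Poly_Mapping.keys g \<subseteq> E"
  then show "Poly_Mapping.keys (f + g) \<subseteq> E" using keys_add[of f g] by blast
next
  fix r f :: "'k poly_xy"
  assume "Poly_Mapping.keys f \<subseteq> E"
  then have "Poly_Mapping.keys r + Poly_Mapping.keys f \<subseteq> E"
    using upward_closedD[OF assms] by (blast elim: set_plus_elim)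
  then show "Poly_Mapping.keys (r * f) \<subseteq> E"
    using keys_mult_subset[of r f] by blast
qed

lemma monom_xy_add: "monom_xy (u + v) = monom_xy u * monom_xy v"
  by (simp add: monom_xy_def mult_single)

lemma monom_xy_in_exponent_ideal_iff: "monom_xy u \<in> exponent_ideal E \<longleftrightarrow> u \<in> E"
  by (simp add: monom_xy_def exponent_ideal_def)

lemma poly_xy_eq_sum_monom:
  fixes p :: "'k::field poly_xy"
  shows "p = (\<Sum>u\<in>Poly_Mapping.keys p. Poly_Mapping.single 0 (Poly_Mapping.lookup p u) * monom_xy u)"
  by (rule poly_mapping_eqI)
    (simp add: monom_xy_def mult_single lookup_sum lookup_single when_def in_keys_iff)

lemma ideal_gen_monomials:
  "ideal_gen (monom_xy ` S) = (exponent_ideal (UNIV + S) :: 'k::field poly_xy set)"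
proof (rule antisym)
  have "monom_xy ` S \<subseteq> (exponent_ideal (UNIV + S) :: 'k poly_xy set)"
    using set_plus_intro[of 0 UNIV _ S] by (auto simp: monom_xy_in_exponent_ideal_iff)
  then show "ideal_gen (monom_xy ` S) \<subseteq> (exponent_ideal (UNIV + S) :: 'k poly_xy set)"
    by (rule ideal_gen_least) (rule is_ideal_exponent_ideal[OF upward_closed_UNIV_plus])
next
  let ?J = "ideal_gen (monom_xy ` S) :: 'k poly_xy set"
  have mult: "r * f \<in> ?J" if "f \<in> ?J" for r f
    using is_ideal_ideal_gen that unfolding is_ideal_iff by blast
  have monom: "monom_xy u \<in> ?J" if u: "u \<in> UNIV + S" for u
  proof -
    obtain t s where "u = t + s" and "s \<in> S" using u by (rule set_plus_elim)
    then show ?thesis by (auto simp: monom_xy_add intro: mult ideal_gen_superset)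
  qed
  show "exponent_ideal (UNIV + S) \<subseteq> ?J"
  proof
    fix p :: "'k poly_xy"
    assume "p \<in> exponent_ideal (UNIV + S)"
    then show "p \<in> ?J"
      by (subst poly_xy_eq_sum_monom)
        (auto simp: exponent_ideal_def intro!: is_ideal_sum is_ideal_ideal_gen mult monom)
  qed
qed

lemma UNIV_plus_upward_closed: "upward_closed E \<Longrightarrow> UNIV + E = E"
proof (rule antisym)
  assume "upward_closed E"
  then show "UNIV + E \<subseteq> E" by (blast elim: set_plus_elim intro: upward_closedD)
  show "E \<subseteq> UNIV + E" using set_plus_intro[of 0 UNIV _ E] by auto
qed

lemma ideal_times_exponent_ideal:
  assumes "upward_closed E" and "upward_closed F"
  shows "ideal_times (exponent_ideal E) (exponent_ideal F) =
    (exponent_ideal (E + F) :: 'k::field poly_xy set)"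
proof (rule antisym)
  have up: "upward_closed (E + F)"
    using assms(1) by (rule upward_closed_set_plus)
  show "ideal_times (exponent_ideal E) (exponent_ideal F) \<subseteq>
      (exponent_ideal (E + F) :: 'k poly_xy set)"
    unfolding ideal_times_def
  proof (rule ideal_gen_least[OF _ is_ideal_exponent_ideal[OF up]], safe)
    fix f g :: "'k poly_xy"
    assume "f \<in> exponent_ideal E" and "g \<in> exponent_ideal F"
    then show "f * g \<in> exponent_ideal (E + F)"
      unfolding exponent_ideal_def
      using keys_mult_subset[of f g] set_plus_mono2[of _ E _ F] by blast
  qed
  have "monom_xy ` (E + F) \<subseteq> (ideal_times (exponent_ideal E) (exponent_ideal F) :: 'k poly_xy set)"
  proof (intro subsetI, elim imageE set_plus_elim)
    fix p :: "'k poly_xy" and u e f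
    assume *: "p = monom_xy u" "u = e + f" "e \<in> E" "f \<in> F"
    then have "p = monom_xy e * monom_xy f"
      and "monom_xy e \<in> (exponent_ideal E :: 'k poly_xy set)"
      and "monom_xy f \<in> (exponent_ideal F :: 'k poly_xy set)"
      by (simp_all add: monom_xy_add monom_xy_in_exponent_ideal_iff)
    then show "p \<in> ideal_times (exponent_ideal E) (exponent_ideal F)"
      unfolding ideal_times_def by (intro ideal_gen_superset) blast
  qed
  from ideal_gen_least[OF this]
  show "exponent_ideal (E + F) \<subseteq>
      (ideal_times (exponent_ideal E) (exponent_ideal F) :: 'k poly_xy set)"
    by (simp add: ideal_gen_monomials UNIV_plus_upward_closed[OF up] ideal_times_def
        is_ideal_ideal_gen)
qed

lemma ideal_times_UNIV:
  assumes "is_ideal I"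
  shows "ideal_times I UNIV = I"
proof (rule antisym)
  show "ideal_times I UNIV \<subseteq> I"
    unfolding ideal_times_def
  proof (intro ideal_gen_least assms subsetI, clarify)
    fix f g assume "f \<in> I"
    then have "g * f \<in> I" using assms by (simp add: is_ideal_iff)
    then show "f * g \<in> I" by (simp add: mult.commute)
  qed
  show "I \<subseteq> ideal_times I UNIV"
    unfolding ideal_times_def by (metis (mono_tags, lifting) UNIV_I ideal_gen_superset mem_Collect_eq
        mult.right_neutral subsetI)
qed

section \<open>The number of generators of a monomial ideal\<close>

definition minimal_exponents :: "(nat \<times> nat) set \<Rightarrow> (nat \<times> nat) set" where
  "minimal_exponents E = {u \<in> E. \<forall>t v. v \<in> E \<longrightarrow> u = t + v \<longrightarrow> t = 0}"

lemma UNIV_plus_minimal_exponents: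
  assumes "upward_closed E"
  shows "UNIV + minimal_exponents E = E"
proof (rule antisym)
  show "UNIV + minimal_exponents E \<subseteq> E"
    unfolding minimal_exponents_def by (blast elim: set_plus_elim intro: upward_closedD[OF assms])
  have "u \<in> UNIV + minimal_exponents E" if "u \<in> E" for u
    using that
  proof (induction "deg_xy u" arbitrary: u rule: less_induct)
    case less
    show ?case
    proof (cases "u \<in> minimal_exponents E")
      case True
      then show ?thesis using set_plus_intro[of 0 UNIV u] by simp
    next
      case False
      then obtain t v where "v \<in> E" and u: "u = t + v" and "t \<noteq> 0"
        using less.prems unfolding minimal_exponents_def by blast
      moreover have "deg_xy v < deg_xy u"
        using \<open>t \<noteq> 0\<close> by (auto simp: u deg_xy_def prod_eq_iff)
      ultimately have "v \<in> UNIV + minimal_exponents E" using less.hyps by blast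
      then show ?thesis
        unfolding u by (rule upward_closedD[OF upward_closed_UNIV_plus])
    qed
  qed
  then show "E \<subseteq> UNIV + minimal_exponents E" by blast
qed

text \<open>
  Only the constant term of \<open>r\<close> can contribute, because no exponent of \<open>p\<close> lies strictly below
  a minimal one.  Thus multiplication by \<open>r\<close> acts on the coefficients at the minimal exponents as a
  scalar, which reduces questions about generators of the ideal to linear algebra over the field.
\<close>

lemma lookup_mult_at_minimal_exponent:
  fixes r p :: "'k::field poly_xy"
  assumes u: "u \<in> minimal_exponents E" and p: "p \<in> exponent_ideal E"
  shows "Poly_Mapping.lookup (r * p) u = Poly_Mapping.lookup r 0 * Poly_Mapping.lookup p u"
proof -
  let ?c = "Poly_Mapping.single 0 (Poly_Mapping.lookup r 0)"
  define r' where "r' = r - ?c"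
  have "u \<notin> Poly_Mapping.keys (r' * p)"
  proof
    assume "u \<in> Poly_Mapping.keys (r' * p)"
    then obtain t v where "t \<in> Poly_Mapping.keys r'" and "v \<in> E" and "u = t + v"
      using keys_mult_subset[of r' p] p unfolding exponent_ideal_def by (blast elim: set_plus_elim)
    moreover from this u have "t = 0"
      unfolding minimal_exponents_def by blast
    ultimately show False
      by (simp add: r'_def in_keys_iff lookup_minus)
  qed
  moreover have "r * p = ?c * p + r' * p"
    by (simp add: r'_def algebra_simps)
  moreover have "Poly_Mapping.lookup (?c * p) u = Poly_Mapping.lookup r 0 * Poly_Mapping.lookup p u"
    by (simp flip: mult_map_scale_conv_mult add: Poly_Mapping.map.rep_eq when_def)
  ultimately show ?thesis
    by (simp add: lookup_add in_keys_iff)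
qed

text \<open>
  Reading off the coefficients at the minimal exponents maps the ideal onto a space containing the
  unit vectors.  Since ring multiplication becomes scalar multiplication there, the images of
  any ideal generators span this space linearly, so there are at least as many generators as unit
  vectors.
\<close>

lemma card_minimal_exponents_le:
  fixes G :: "'k::field poly_xy set"
  assumes "finite G" and gen: "ideal_gen G = exponent_ideal E"
  shows "card (minimal_exponents E) \<le> card G"
proof -
  interpret exponent_fun: vector_space "\<lambda>(c::'k) (f :: nat \<times> nat \<Rightarrow> 'k) u. c * f u"
    by unfold_locales (auto simp: algebra_simps fun_eq_iff)
  define M where "M = minimal_exponents E"
  define \<pi> :: "'k poly_xy \<Rightarrow> nat \<times> nat \<Rightarrow> 'k"
    where "\<pi> p = (\<lambda>u. if u \<in> M then Poly_Mapping.lookup p u else 0)" for p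
  define \<delta> :: "nat \<times> nat \<Rightarrow> nat \<times> nat \<Rightarrow> 'k" where "\<delta> u = (\<lambda>v. if v = u then 1 else 0)" for u
  \<comment> \<open>The members of \<open>?J\<close> form an ideal that contains \<open>G\<close>; so they fill the ideal generated by \<open>G\<close>.\<close>
  let ?W = "exponent_fun.span (\<pi> ` G)"
  let ?J = "{p \<in> exponent_ideal E. \<pi> p \<in> ?W}"
  have "is_ideal (exponent_ideal E :: 'k poly_xy set)"
    using is_ideal_ideal_gen[of G] gen by simp
  moreover have "\<pi> 0 = 0" "\<pi> (p + q) = \<pi> p + \<pi> q" for p q
    by (auto simp: \<pi>_def lookup_add)
  moreover have "\<pi> (r * p) = (\<lambda>u. Poly_Mapping.lookup r 0 * \<pi> p u)" if "p \<in> exponent_ideal E" for r p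
    using lookup_mult_at_minimal_exponent[OF _ that, of _ r] by (auto simp: \<pi>_def M_def)
  ultimately have "is_ideal ?J"
    by (auto simp: is_ideal_iff intro: exponent_fun.span_zero exponent_fun.span_add
        exponent_fun.span_scale)
  moreover have "G \<subseteq> ?J"
    using ideal_gen_superset[of _ G] gen by (auto intro: exponent_fun.span_base)
  ultimately have image: "\<pi> p \<in> ?W" if "p \<in> exponent_ideal E" for p
    using ideal_gen_least[of G ?J] gen that by blast
  have "\<delta> u \<in> ?W" if "u \<in> M" for u
  proof -
    have "\<pi> (monom_xy u) = \<delta> u"
      using that by (auto simp: \<pi>_def \<delta>_def monom_xy_def lookup_single when_def)
    then show ?thesis
      using image[of "monom_xy u"] that
      by (simp add: monom_xy_in_exponent_ideal_iff M_def minimal_exponents_def)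
  qed
  moreover have "exponent_fun.independent (\<delta> ` M)"
    unfolding exponent_fun.dependent_def
  proof (rule notI, elim bexE imageE)
    fix a u assume "u \<in> M" and a: "a = \<delta> u" and "a \<in> exponent_fun.span (\<delta> ` M - {a})"
    moreover have "exponent_fun.span (\<delta> ` M - {\<delta> u}) \<subseteq> {f. f u = 0}"
      by (rule exponent_fun.span_minimal) (auto simp: \<delta>_def exponent_fun.subspace_def)
    ultimately have "\<delta> u u = 0" by blast
    then show False by (simp add: \<delta>_def)
  qed
  ultimately have "card (\<delta> ` M) \<le> card (\<pi> ` G)"
    using exponent_fun.independent_span_bound[of "\<pi> ` G" "\<delta> ` M"] assms(1) by blast
  also have "\<dots> \<le> card G"
    using assms(1) by (rule card_image_le)
  finally have "card (\<delta> ` M) \<le> card G" .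
  moreover have "inj_on \<delta> M"
    by (rule inj_onI) (metis \<delta>_def zero_neq_one)
  ultimately show ?thesis
    by (simp add: card_image M_def)
qed

lemma mu_exponent_ideal:
  assumes "upward_closed E" and "finite (minimal_exponents E)"
  shows "mu (exponent_ideal E :: 'k::field poly_xy set) = card (minimal_exponents E)"
  unfolding mu_def
proof (rule Least_equality)
  have "inj_on (monom_xy :: _ \<Rightarrow> 'k poly_xy) (minimal_exponents E)"
    by (metis inj_onI insertI1 keys_single monom_xy_def one_neq_zero singletonD)
  moreover have "ideal_gen (monom_xy ` minimal_exponents E) = (exponent_ideal E :: 'k poly_xy set)"
    by (simp add: ideal_gen_monomials UNIV_plus_minimal_exponents assms(1))
  ultimately show "\<exists>G. finite G \<and> card G = card (minimal_exponents E) \<and>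
      ideal_gen G = (exponent_ideal E :: 'k poly_xy set)"
    using assms(2) by (metis card_image finite_imageI)
qed (auto intro: card_minimal_exponents_le)

section \<open>Lexsegment staircases\<close>

text \<open>
  The last condition is the lexsegment property for neighbouring monomials of the same degree.
  Repeating the exchange yields the property for arbitrary ones.
\<close>

definition lexsegment_staircase :: "(nat \<times> nat) set \<Rightarrow> bool" where
  "lexsegment_staircase E \<longleftrightarrow> upward_closed E \<and> E \<noteq> {} \<and>
    (\<forall>a b. (a, Suc b) \<in> E \<longrightarrow> (Suc a, b) \<in> E)"

definition x_intercept :: "(nat \<times> nat) set \<Rightarrow> nat" where
  "x_intercept E = (LEAST a. (a, 0) \<in> E)"

definition min_x_degree :: "(nat \<times> nat) set \<Rightarrow> nat" where
  "min_x_degree E = (LEAST a. \<exists>b. (a, b) \<in> E)"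

lemma upward_closed_ge:
  assumes "upward_closed E" and "(a, b) \<in> E" and "a \<le> c" and "b \<le> d"
  shows "(c, d) \<in> E"
  using upward_closedD[OF assms(1,2), of "(c - a, d - b)"] assms(3,4) by simp

lemma x_intercept_mem:
  assumes "lexsegment_staircase E"
  shows "(x_intercept E, 0) \<in> E"
proof -
  obtain a b where "(a, b) \<in> E"
    using assms unfolding lexsegment_staircase_def by auto
  then have "\<exists>c. (c, 0) \<in> E"
  proof (induction b arbitrary: a)
    case (Suc b)
    then show ?case using assms unfolding lexsegment_staircase_def by blast
  qed blast
  then show ?thesis unfolding x_intercept_def by (rule LeastI_ex)
qed

lemma min_x_degree_mem:
  assumes "lexsegment_staircase E"
  obtains b where "(min_x_degree E, b) \<in> E"
  using LeastI_ex[of "\<lambda>a. \<exists>b. (a, b) \<in> E"] x_intercept_mem[OF assms]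
  unfolding min_x_degree_def by blast

lemma x_intercept_le: "(a, 0) \<in> E \<Longrightarrow> x_intercept E \<le> a"
  unfolding x_intercept_def by (rule Least_le)

lemma min_x_degree_le: "(a, b) \<in> E \<Longrightarrow> min_x_degree E \<le> a"
  unfolding min_x_degree_def by (rule Least_le) blast

lemma min_x_degree_le_x_intercept:
  "lexsegment_staircase E \<Longrightarrow> min_x_degree E \<le> x_intercept E"
  by (rule min_x_degree_le[OF x_intercept_mem])

text \<open>
  Each column \<open>a\<close> between the two bounds meets \<open>E\<close>; let \<open>(a, b)\<close> be its lowest point.  If a
  point of \<open>E\<close> lay to the left of it at height \<open>b\<close>, then either \<open>b = 0\<close> and \<open>a\<close> would exceed the
  intercept, or the exchange of a \<open>y\<close> for an \<open>x\<close> would give a point of column \<open>a\<close> below \<open>b\<close>.  So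
  \<open>(a, b)\<close> is minimal.  Conversely, a point to the right of the intercept is never minimal.
\<close>

lemma bij_betw_minimal_exponents:
  assumes E: "lexsegment_staircase E"
  shows "bij_betw fst (minimal_exponents E) {min_x_degree E..x_intercept E}"
proof (rule bij_betw_imageI)
  have up: "upward_closed E"
    and shift: "\<And>a b. (a, Suc b) \<in> E \<Longrightarrow> (Suc a, b) \<in> E"
    using E unfolding lexsegment_staircase_def by blast+
  have minD: "(a, b) = (c, d)"
    if "(a, b) \<in> minimal_exponents E" "(c, d) \<in> E" "c \<le> a" "d \<le> b" for a b c d
  proof -
    have "(a, b) = (a - c, b - d) + (c, d)" using that by simp
    then have "(a - c, b - d) = 0" using that(1,2) unfolding minimal_exponents_def by blast
    then show ?thesis using that(3,4) by (simp add: zero_prod_def)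
  qed
  have in_E: "u \<in> E" if "u \<in> minimal_exponents E" for u
    using that by (simp add: minimal_exponents_def)
  show "inj_on fst (minimal_exponents E)"
  proof (rule inj_onI)
    fix u v assume *: "u \<in> minimal_exponents E" "v \<in> minimal_exponents E" "fst u = fst v"
    obtain a b d where uv: "u = (a, b)" "v = (a, d)"
      using *(3) by (metis prod.collapse)
    show "u = v"
      using minD[of a b a d] minD[of a d a b] in_E * unfolding uv by (cases "d \<le> b") auto
  qed
  show "fst ` minimal_exponents E = {min_x_degree E..x_intercept E}"
  proof (intro antisym subsetI)
    fix a assume "a \<in> fst ` minimal_exponents E"
    then obtain b where ab: "(a, b) \<in> minimal_exponents E" by auto
    have "a \<le> x_intercept E"
      using minD[OF ab x_intercept_mem[OF E]] by (cases "x_intercept E \<le> a") auto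
    then show "a \<in> {min_x_degree E..x_intercept E}"
      using min_x_degree_le[OF in_E[OF ab]] by simp
  next
    fix a assume a: "a \<in> {min_x_degree E..x_intercept E}"
    \<comment> \<open>The lowest point of column \<open>a\<close> is the preimage of \<open>a\<close>.\<close>
    define b where "b = (LEAST b. (a, b) \<in> E)"
    obtain b0 where "(min_x_degree E, b0) \<in> E" using E by (rule min_x_degree_mem)
    then have "(a, b0) \<in> E"
      using a by (intro upward_closed_ge[OF up \<open>(min_x_degree E, b0) \<in> E\<close>]) simp_all
    then have ab: "(a, b) \<in> E" unfolding b_def by (rule LeastI)
    have b_le: "b \<le> d" if "(a, d) \<in> E" for d
      unfolding b_def using that by (rule Least_le)
    have left: "a \<le> c" if "(c, b) \<in> E" for c
    proof (rule ccontr)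
      assume "\<not> a \<le> c"
      show False
      proof (cases b)
        case 0
        then show False using that x_intercept_le[of c E] a \<open>\<not> a \<le> c\<close> by simp
      next
        case (Suc b')
        then have "(Suc c, b') \<in> E" using shift that by simp
        then have "(a, b') \<in> E"
          using upward_closed_ge[OF up, of "Suc c" b' a b'] \<open>\<not> a \<le> c\<close> by simp
        then show False using b_le[of b'] Suc by simp
      qed
    qed
    have "t = 0" if "v \<in> E" "(a, b) = t + v" for t v
    proof -
      obtain c d where v: "v = (c, d)" by fastforce
      have t: "c \<le> a" "d \<le> b" "t = (a - c, b - d)"
        using that(2) unfolding v by (auto simp: prod_eq_iff)
      have "a \<le> c" using left upward_closed_ge[OF up _ order_refl t(2)] that(1) unfolding v by blast
      moreover have "b \<le> d" using b_le upward_closed_ge[OF up _ t(1) order_refl] that(1) unfolding v by blast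
      ultimately show ?thesis by (simp add: t zero_prod_def)
    qed
    then have "(a, b) \<in> minimal_exponents E"
      using ab unfolding minimal_exponents_def by blast
    then show "a \<in> fst ` minimal_exponents E" by force
  qed
qed

lemma mu_lexsegment_staircase:
  assumes "lexsegment_staircase E"
  shows "int (mu (exponent_ideal E :: 'k::field poly_xy set)) =
    int (x_intercept E) - int (min_x_degree E) + 1"
proof -
  note bij = bij_betw_minimal_exponents[OF assms]
  have "mu (exponent_ideal E :: 'k poly_xy set) = card (minimal_exponents E)"
    using assms bij_betw_finite[OF bij] unfolding lexsegment_staircase_def
    by (intro mu_exponent_ideal) auto
  then show ?thesis
    using bij_betw_same_card[OF bij] min_x_degree_le_x_intercept[OF assms] by simp
qed

text \<open>
  If a sum of two exponents has a factor \<open>y\<close> to exchange, so has one of the summands.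
\<close>

lemma lexsegment_staircase_plus:
  assumes "lexsegment_staircase E" and "lexsegment_staircase F"
  shows "lexsegment_staircase (E + F)"
  unfolding lexsegment_staircase_def
proof (intro conjI allI impI)
  show "upward_closed (E + F)"
    using assms(1) by (auto simp: lexsegment_staircase_def intro: upward_closed_set_plus)
  show "E + F \<noteq> {}"
    using set_plus_intro[OF assms[THEN x_intercept_mem]] by blast
  fix a b assume "(a, Suc b) \<in> E + F"
  then obtain c d c' d' where E: "(c, d) \<in> E" and F: "(c', d') \<in> F"
    and eq: "a = c + c'" "Suc b = d + d'"
    by (auto elim!: set_plus_elim)
  show "(Suc a, b) \<in> E + F"
  proof (cases d)
    case 0
    then have "(Suc c', b) \<in> F" using assms(2) F eq by (simp add: lexsegment_staircase_def)
    then show ?thesis using set_plus_intro[OF E] 0 eq by fastforce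
  next
    case (Suc e)
    then have "(Suc c, e) \<in> E" using assms(1) E by (simp add: lexsegment_staircase_def)
    then show ?thesis using set_plus_intro[OF _ F] Suc eq by fastforce
  qed
qed

lemma x_intercept_plus:
  assumes "lexsegment_staircase E" and "lexsegment_staircase F"
  shows "x_intercept (E + F) = x_intercept E + x_intercept F"
proof (rule antisym)
  show "x_intercept (E + F) \<le> x_intercept E + x_intercept F"
    using set_plus_intro[OF assms[THEN x_intercept_mem]] by (simp add: x_intercept_le)
  have "(x_intercept (E + F), 0) \<in> E + F"
    using assms by (intro x_intercept_mem lexsegment_staircase_plus)
  then show "x_intercept E + x_intercept F \<le> x_intercept (E + F)"
    by (auto elim!: set_plus_elim simp: zero_prod_def intro!: add_mono x_intercept_le)
qed

lemma min_x_degree_plus: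
  assumes "lexsegment_staircase E" and "lexsegment_staircase F"
  shows "min_x_degree (E + F) = min_x_degree E + min_x_degree F"
proof (rule antisym)
  obtain b c where "(min_x_degree E, b) \<in> E" and "(min_x_degree F, c) \<in> F"
    using assms by (metis min_x_degree_mem)
  from set_plus_intro[OF this]
  show "min_x_degree (E + F) \<le> min_x_degree E + min_x_degree F"
    by (auto intro: min_x_degree_le)
  obtain d where "(min_x_degree (E + F), d) \<in> E + F"
    using min_x_degree_mem[OF lexsegment_staircase_plus[OF assms]] .
  then show "min_x_degree E + min_x_degree F \<le> min_x_degree (E + F)"
    by (auto elim!: set_plus_elim intro!: add_mono min_x_degree_le)
qed

section \<open>Products of lexsegment ideals\<close>

text \<open>
  The ideal has to be nonzero for its staircase to be nonempty and hence to reach the \<open>x\<close>-axis.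
\<close>

lemma lexsegment_ideal_exponents:
  fixes I :: "'k::field poly_xy set"
  assumes "lexsegment_ideal I" and "I \<noteq> {0}"
  obtains E where "lexsegment_staircase E" and "I = exponent_ideal E"
proof -
  from assms(1) obtain S where "I = ideal_gen (monom_xy ` S)"
    unfolding lexsegment_ideal_def monomial_ideal_def by blast
  then have I: "I = exponent_ideal (UNIV + S)"
    by (simp add: ideal_gen_monomials)
  have "UNIV + S \<noteq> {}"
    using assms(2) by (auto simp: I exponent_ideal_def)
  moreover have "(Suc a, b) \<in> UNIV + S" if "(a, Suc b) \<in> UNIV + S" for a b
  proof -
    have "monom_xy (a, Suc b) \<in> I"
      using that by (simp add: I monom_xy_in_exponent_ideal_iff)
    moreover have "deg_xy (Suc a, b) = deg_xy (a, Suc b)" "lex_greater (Suc a, b) (a, Suc b)"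
      by (simp_all add: deg_xy_def lex_greater_def)
    ultimately have "monom_xy (Suc a, b) \<in> I"
      using assms(1) unfolding lexsegment_ideal_def by blast
    then show ?thesis by (simp add: I monom_xy_in_exponent_ideal_iff)
  qed
  ultimately have "lexsegment_staircase (UNIV + S)"
    using upward_closed_UNIV_plus unfolding lexsegment_staircase_def by blast
  then show thesis using I by (rule that)
qed

lemma mu_ideal_times_lexsegment:
  fixes I J :: "'k::field poly_xy set"
  assumes "lexsegment_ideal I" "I \<noteq> {0}" and "lexsegment_ideal J" "J \<noteq> {0}"
  shows "int (mu (ideal_times I J)) = int (mu I) + int (mu J) - 1"
proof -
  obtain E where E: "lexsegment_staircase E" "I = exponent_ideal E"
    using assms(1,2) by (rule lexsegment_ideal_exponents)
  obtain F where F: "lexsegment_staircase F" "J = exponent_ideal F"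
    using assms(3,4) by (rule lexsegment_ideal_exponents)
  have "ideal_times I J = exponent_ideal (E + F)"
    using E F by (simp add: lexsegment_staircase_def ideal_times_exponent_ideal)
  moreover note mu_lexsegment_staircase[OF lexsegment_staircase_plus[OF E(1) F(1)], where 'k='k]
  ultimately show ?thesis
    using E F by (simp add: mu_lexsegment_staircase x_intercept_plus min_x_degree_plus)
qed

theorem corollary4p6:
  fixes I :: "'k::field poly_xy set"
  assumes "lexsegment_ideal I" and "I \<noteq> {0}"
  shows "int (mu (ideal_power I 2)) = 2 * int (mu I) - 1"
proof -
  have "is_ideal I"
    using assms(1) is_ideal_ideal_gen unfolding lexsegment_ideal_def monomial_ideal_def by blast
  then have "ideal_power I 2 = ideal_times I I"
    by (simp add: numeral_2_eq_2 ideal_times_UNIV)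
  then show ?thesis
    using mu_ideal_times_lexsegment[OF assms assms] by simp
qed

end
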